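(* For every $n\ge 1$, the set $\mathcal T_n^0$ is dense in $\mathcal T_n$ and is of the second category in $\mathcal T_n$ (that is, it is not a countable union of nowhere dense subsets of $\mathcal T_n$).
   Context: $\mathcal T_n$ denotes the space of real antisymmetric $n\times n$ matrices, with its usual topology as a finite-dimensional real vector space. $O(n,n|\mathbf R)$ is the group of linear transformations of $\mathbf R^{2n}$, with coordinates $(a^1,\dots,a^n,b_1,\dots,b_n)$, preserving the quadratic form $\sum_i a^ib_i$. Its elements are written in $n\times n$ blocks $g=\begin{pmatrix}A&B\\ C&D\end{pmatrix}$ (so $A^tC+C^tA=0=B^tD+D^tB$ and $A^tD+C^tB=1$). $SO(n,n|\mathbf Z)$ is the subgroup of elements with integer entries and determinant $+1$. For $\theta\in\mathcal T_n$ such that $C\theta+D$ is invertible, one says that $g\theta$ is defined and sets $g\theta=(A\theta+B)(C\theta+D)^{-1}$, which is again in $\mathcal T_n$. Finally $$\mathcal T_n^0=\{\theta\in\mathcal T_n:\ g\theta\text{ is defined for all }g\in SO(n,n|\mathbf Z)\}.$$ *)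

theory Defs
  imports "HOL-Analysis.Analysis"
begin

definition antisym_matrices :: "(real^'n^'n) set" where
  "antisym_matrices = {\<theta>. transpose \<theta> = - \<theta>}"

(* R^(2n) is indexed by the type 'n + 'n: the coordinates a^i are the Inl-components,
   the coordinates b_i the Inr-components. *)
definition split_form :: "real^('n::finite + 'n) \<Rightarrow> real" where
  "split_form v = (\<Sum>i\<in>UNIV. v $ Inl i * v $ Inr i)"

(* Linear transformations are given by their matrices; preserving the nondegenerate form
   makes them invertible. *)
definition Onn :: "(real^('n::finite + 'n)^('n + 'n)) set" where
  "Onn = {g. \<forall>v. split_form (g *v v) = split_form v}"

definition SOnnZ :: "(real^('n::finite + 'n)^('n + 'n)) set" where
  "SOnnZ = {g \<in> Onn. (\<forall>i j. g $ i $ j \<in> \<int>) \<and> det g = 1}"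

definition blockC :: "real^('n::finite + 'n)^('n + 'n) \<Rightarrow> real^'n^'n" where
  "blockC g = (\<chi> i j. g $ Inr i $ Inl j)"

definition blockD :: "real^('n::finite + 'n)^('n + 'n) \<Rightarrow> real^'n^'n" where
  "blockD g = (\<chi> i j. g $ Inr i $ Inr j)"

(* g = (A B; C D) acts by \<theta> \<mapsto> (A \<theta> + B) (C \<theta> + D)^-1 whenever C \<theta> + D is invertible;
   only the domain of this partial action is needed here. *)
definition action_defined :: "real^('n::finite + 'n)^('n + 'n) \<Rightarrow> real^'n^'n \<Rightarrow> bool" where
  "action_defined g \<theta> \<longleftrightarrow> invertible (blockC g ** \<theta> + blockD g)"

definition antisym_matrices0 :: "(real^'n^'n) set" where
  "antisym_matrices0 = {\<theta> \<in> antisym_matrices. \<forall>g\<in>SOnnZ. action_defined g \<theta>}"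

definition nowhere_dense_in :: "'a topology \<Rightarrow> 'a set \<Rightarrow> bool" where
  "nowhere_dense_in X S \<longleftrightarrow>
    S \<subseteq> topspace X \<and> X interior_of (X closure_of S) = {}"

definition first_category_in :: "'a topology \<Rightarrow> 'a set \<Rightarrow> bool" where
  "first_category_in X S \<longleftrightarrow>
    (\<exists>\<N>. countable \<N> \<and> (\<forall>N\<in>\<N>. nowhere_dense_in X N) \<and> S = \<Union>\<N>)"

definition second_category_in :: "'a topology \<Rightarrow> 'a set \<Rightarrow> bool" where
  "second_category_in X S \<longleftrightarrow> S \<subseteq> topspace X \<and> \<not> first_category_in X S"

end

theory Submission
  imports Defs
begin

text \<open>
  By Baire it suffices that for each of the countably many \<open>g\<close> the polynomial
  \<open>\<theta> \<mapsto> det (C \<theta> + D)\<close> does not vanish identically on the antisymmetric matrices.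
  Since \<open>C D\<^sup>t\<close> is antisymmetric and \<open>(C D)\<close> has full rank, \<open>C + D\<close> is invertible. Expanding
  its determinant in the columns yields a set \<open>S\<close> of indices such that taking the columns in \<open>S\<close>
  from \<open>C\<close> and the others from \<open>D\<close> gives an invertible matrix. This matrix is the lower right
  block of \<open>g\<close> times the swap of \<open>a\<^sup>i\<close> and \<open>b\<^sub>i\<close> for \<open>i \<in> S\<close>, which has determinant
  \<open>(- 1) ^ card S\<close>. Elements of \<open>O(n,n)\<close> with invertible lower right block have positive
  determinant, so \<open>det g = 1\<close> forces \<open>card S\<close> to be even. Hence there is an antisymmetric
  \<open>J\<close> supported on \<open>S\<close> with \<open>J\<^sup>2 = - 1\<close> there, and \<open>\<theta> = J / s\<close> works for all but finitely
  many \<open>s\<close>.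
\<close>

section \<open>Block matrices over the index type \<open>'n + 'n\<close>\<close>

definition block_matrix ::
    "real^'n^'n \<Rightarrow> real^'n^'n \<Rightarrow> real^'n^'n \<Rightarrow> real^'n^'n \<Rightarrow> real^('n::finite + 'n)^('n + 'n)" where
  "block_matrix A B C D = (\<chi> i j. case i of
      Inl i' \<Rightarrow> (case j of Inl j' \<Rightarrow> A $ i' $ j' | Inr j' \<Rightarrow> B $ i' $ j')
    | Inr i' \<Rightarrow> (case j of Inl j' \<Rightarrow> C $ i' $ j' | Inr j' \<Rightarrow> D $ i' $ j'))"

lemma block_matrix_nth [simp]:
  "block_matrix A B C D $ Inl i $ Inl j = A $ i $ j"
  "block_matrix A B C D $ Inl i $ Inr j = B $ i $ j"
  "block_matrix A B C D $ Inr i $ Inl j = C $ i $ j"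
  "block_matrix A B C D $ Inr i $ Inr j = D $ i $ j"
  by (simp_all add: block_matrix_def)

lemma sum_UNIV_Plus:
  fixes f :: "'a::finite + 'b::finite \<Rightarrow> 'c::comm_monoid_add"
  shows "sum f UNIV = (\<Sum>i\<in>UNIV. f (Inl i)) + (\<Sum>i\<in>UNIV. f (Inr i))"
  by (simp add: UNIV_Plus_UNIV [symmetric] sum.Plus del: UNIV_Plus_UNIV)

lemma sum_type_matrix_eqI:
  fixes M N :: "real^('n::finite + 'n)^('n + 'n)"
  assumes "\<And>i j. M $ Inl i $ Inl j = N $ Inl i $ Inl j" "\<And>i j. M $ Inl i $ Inr j = N $ Inl i $ Inr j"
    "\<And>i j. M $ Inr i $ Inl j = N $ Inr i $ Inl j" "\<And>i j. M $ Inr i $ Inr j = N $ Inr i $ Inr j"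
  shows "M = N"
proof -
  have "M $ i $ j = N $ i $ j" for i j
    using assms by (cases i; cases j) auto
  then show ?thesis by (simp add: vec_eq_iff)
qed

lemma block_matrix_mult:
  "block_matrix A B C D ** block_matrix A' B' C' D' =
   block_matrix (A ** A' + B ** C') (A ** B' + B ** D') (C ** A' + D ** C') (C ** B' + D ** D')"
  by (rule sum_type_matrix_eqI) (simp_all add: matrix_matrix_mult_def sum_UNIV_Plus)

lemma transpose_zero_matrix [simp]: "transpose 0 = 0"
  by (simp add: transpose_def vec_eq_iff)

lemma transpose_block_matrix:
  "transpose (block_matrix A B C D) =
   block_matrix (transpose A) (transpose C) (transpose B) (transpose D)"
  by (rule sum_type_matrix_eqI) (simp_all add: transpose_def)

lemma block_matrix_one: "block_matrix (mat 1) 0 0 (mat 1) = mat 1"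
  by (rule sum_type_matrix_eqI) (simp_all add: mat_def)

lemma block_matrix_eq_iff:
  "block_matrix A B C D = block_matrix A' B' C' D' \<longleftrightarrow> A = A' \<and> B = B' \<and> C = C' \<and> D = D'"
proof
  assume eq: "block_matrix A B C D = block_matrix A' B' C' D'"
  show "A = A' \<and> B = B' \<and> C = C' \<and> D = D'"
    using arg_cong[OF eq, of "\<lambda>M. M $ Inl i $ Inl j" for i j]
      arg_cong[OF eq, of "\<lambda>M. M $ Inl i $ Inr j" for i j]
      arg_cong[OF eq, of "\<lambda>M. M $ Inr i $ Inl j" for i j]
      arg_cong[OF eq, of "\<lambda>M. M $ Inr i $ Inr j" for i j]
    by (simp add: vec_eq_iff)
qed simp

lemma blockC_block_matrix [simp]: "blockC (block_matrix A B C D) = C"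
  and blockD_block_matrix [simp]: "blockD (block_matrix A B C D) = D"
  by (simp_all add: blockC_def blockD_def vec_eq_iff)

lemma block_matrix_exhaust:
  obtains A B where "g = block_matrix A B (blockC g) (blockD g)"
proof
  show "g = block_matrix (\<chi> i j. g $ Inl i $ Inl j) (\<chi> i j. g $ Inl i $ Inr j) (blockC g) (blockD g)"
    by (rule sum_type_matrix_eqI) (simp_all add: blockC_def blockD_def)
qed

section \<open>The orthogonal group of the split form in matrix terms\<close>

text \<open>Gram matrix of the polar form of \<open>split_form\<close>, whence the factor 2 in
  \<open>inner_swap_matrix\<close>.\<close>

abbreviation swap_matrix :: "real^('n::finite + 'n)^('n + 'n)" where
  "swap_matrix \<equiv> block_matrix 0 (mat 1) (mat 1) 0"

lemma swap_matrix_square: "swap_matrix ** swap_matrix = mat 1"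
  by (simp add: block_matrix_mult block_matrix_one)

text \<open>Polarisation: the quadratic form of the symmetric matrix \<open>M - N\<close> vanishes
  identically, and its value at \<open>axis i 1 + axis j 1\<close> minus those at the two summands
  is twice the entry at \<open>i\<close>, \<open>j\<close>.\<close>

lemma symmetric_matrix_eqI:
  fixes M N :: "real^'n^'n"
  assumes "transpose M = M" "transpose N = N" and eq: "\<And>v. v \<bullet> (M *v v) = v \<bullet> (N *v v)"
  shows "M = N"
proof -
  let ?K = "M - N"
  have z: "v \<bullet> (?K *v v) = 0" for v
    using eq by (simp add: matrix_vector_mult_diff_rdistrib inner_diff_right)
  have e: "axis i 1 \<bullet> (?K *v axis j 1) = ?K $ i $ j" for i j
    by (simp add: inner_axis' matrix_vector_mult_basis column_def)
  have sym: "?K $ i $ j = ?K $ j $ i" for i j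
    using assms(1,2) by (simp add: transpose_def vec_eq_iff)
  have "?K $ i $ j = 0" for i j
    using z[of "axis i 1 + axis j 1"] z[of "axis i 1"] z[of "axis j 1"] sym[of i j]
    by (simp only: matrix_vector_right_distrib inner_add_left inner_add_right e)
  then show ?thesis by (simp add: vec_eq_iff)
qed

lemma inner_swap_matrix: "v \<bullet> (swap_matrix *v v) = 2 * split_form v"
  by (simp add: inner_vec_def matrix_vector_mult_def split_form_def sum_UNIV_Plus mat_def
      if_distrib[of "\<lambda>x. x * _"] cong: if_cong)
    (simp add: mult.commute)

text \<open>Both sides of the identity are symmetric, and their quadratic forms are
  \<open>2 * split_form (g *v v)\<close> and \<open>2 * split_form v\<close>.\<close>

lemma Onn_iff: "g \<in> Onn \<longleftrightarrow> transpose g ** swap_matrix ** g = swap_matrix"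
proof -
  have q: "v \<bullet> ((transpose g ** swap_matrix ** g) *v v) = 2 * split_form (g *v v)" for v
  proof -
    have "v \<bullet> ((transpose g ** swap_matrix ** g) *v v) = v \<bullet> (transpose g *v (swap_matrix *v (g *v v)))"
      by (simp only: matrix_vector_mul_assoc matrix_mul_assoc)
    also have "\<dots> = (g *v v) \<bullet> (swap_matrix *v (g *v v))"
      by (simp only: dot_lmul_matrix[symmetric] vector_transpose_matrix)
    finally show ?thesis by (simp only: inner_swap_matrix)
  qed
  have "transpose g ** swap_matrix ** g = swap_matrix" if "g \<in> Onn"
  proof (rule symmetric_matrix_eqI)
    show "transpose (transpose g ** swap_matrix ** g) = transpose g ** swap_matrix ** g"
      by (simp add: matrix_transpose_mul transpose_block_matrix matrix_mul_assoc)
    show "transpose swap_matrix = swap_matrix"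
      by (simp add: transpose_block_matrix)
  next
    fix v show "v \<bullet> ((transpose g ** swap_matrix ** g) *v v) = v \<bullet> (swap_matrix *v v)"
      using that unfolding q inner_swap_matrix Onn_def by simp
  qed
  moreover have "g \<in> Onn" if "transpose g ** swap_matrix ** g = swap_matrix"
    using q unfolding that inner_swap_matrix Onn_def by simp
  ultimately show ?thesis by blast
qed

text \<open>The left inverse \<open>swap_matrix ** transpose g ** swap_matrix\<close> of
  \<open>g\<close> is also a right inverse. This version relates the rows of \<open>g\<close>, and
  so yields a relation between \<open>C\<close> and \<open>D\<close> alone.\<close>

lemma Onn_transpose:
  assumes "g \<in> Onn" shows "g ** swap_matrix ** transpose g = swap_matrix"
proof -
  have "(swap_matrix ** transpose g ** swap_matrix) ** g = mat 1"
  proof -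
    have "(swap_matrix ** transpose g ** swap_matrix) ** g = swap_matrix ** (transpose g ** swap_matrix ** g)"
      by (simp only: matrix_mul_assoc)
    also have "\<dots> = mat 1"
      using assms by (simp only: Onn_iff swap_matrix_square)
    finally show ?thesis .
  qed
  then have "g ** (swap_matrix ** transpose g ** swap_matrix) = mat 1"
    using matrix_left_right_inverse by blast
  then have "g ** (swap_matrix ** transpose g ** swap_matrix) ** swap_matrix = swap_matrix"
    by (simp only: matrix_mul_lid)
  then have "g ** swap_matrix ** transpose g ** (swap_matrix ** swap_matrix) = swap_matrix"
    by (simp only: matrix_mul_assoc)
  then show ?thesis
    by (simp only: swap_matrix_square matrix_mul_rid)
qed

lemma Onn_mult: "g \<in> Onn \<Longrightarrow> h \<in> Onn \<Longrightarrow> g ** h \<in> Onn"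
  by (simp add: Onn_def flip: matrix_vector_mul_assoc)

section \<open>The sign of the determinant\<close>

text \<open>Unipotent block matrices are squares of unipotent block matrices.\<close>

lemma det_block_unipotent_pos:
  fixes X :: "real^'n^'n"
  shows "0 < det (block_matrix (mat 1) X 0 (mat 1))" "0 < det (block_matrix (mat 1) 0 X (mat 1))"
proof -
  have pos: "0 < det (block_matrix (mat 1) X 0 (mat 1))" for X :: "real^'n^'n"
  proof -
    let ?U = "\<lambda>X :: real^'n^'n. block_matrix (mat 1) X 0 (mat 1)"
    have add: "?U X ** ?U Y = ?U (Y + X)" for X Y
      by (simp add: block_matrix_mult)
    have "det (?U X) * det (?U (- X)) = 1"
      by (simp only: det_mul[symmetric] add block_matrix_one det_I add.left_inverse)
    then have "det (?U X) \<noteq> 0" by auto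
    moreover have "(1/2) *\<^sub>R X + (1/2) *\<^sub>R X = X"
      by (simp flip: scaleR_add_left)
    then have "det (?U X) = det (?U ((1/2) *\<^sub>R X)) * det (?U ((1/2) *\<^sub>R X))"
      by (simp only: det_mul[symmetric] add)
    then have "0 \<le> det (?U X)"
      by (simp only: zero_le_square)
    ultimately show ?thesis by linarith
  qed
  then show "0 < det (block_matrix (mat 1) X 0 (mat 1))" .
  show "0 < det (block_matrix (mat 1) 0 X (mat 1))"
    using pos[of "transpose X"] det_transpose[of "block_matrix (mat 1) 0 X (mat 1)"]
    by (simp add: transpose_block_matrix)
qed

text \<open>Conjugation by \<open>swap_matrix\<close> exchanges the diagonal blocks, and
  transposition preserves determinants. Block-diagonal factors can thus be cancelled without
  evaluating their determinants.\<close>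

lemma det_block_diagonal_swap:
  fixes D :: "real^'n^'n"
  shows "det (block_matrix (transpose D) 0 0 (mat 1)) = det (block_matrix (mat 1) 0 0 D)"
proof -
  have "swap_matrix ** block_matrix (mat 1) 0 0 (transpose D) ** swap_matrix
      = block_matrix (transpose D) 0 0 (mat 1)"
    by (simp add: block_matrix_mult)
  then have "det (block_matrix (transpose D) 0 0 (mat 1))
      = det (swap_matrix :: real^('n + 'n)^('n + 'n)) * det (block_matrix (mat 1) 0 0 (transpose D)) * det (swap_matrix :: real^('n + 'n)^('n + 'n))"
    by (metis det_mul)
  moreover have "det (swap_matrix :: real^('n + 'n)^('n + 'n)) * det (swap_matrix :: real^('n + 'n)^('n + 'n)) = 1"
    by (simp add: swap_matrix_square flip: det_mul)
  ultimately have "det (block_matrix (transpose D) 0 0 (mat 1)) = det (block_matrix (mat 1) 0 0 (transpose D))"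
    by simp
  also have "\<dots> = det (block_matrix (mat 1) 0 0 D)"
    using det_transpose[of "block_matrix (mat 1) 0 0 D"] by (simp add: transpose_block_matrix)
  finally show ?thesis .
qed

text \<open>Block elimination expresses \<open>g\<close> through unipotent matrices, whose
  determinants are positive, and two block-diagonal factors of equal nonzero determinant.\<close>

lemma det_pos_if_blockD_invertible:
  assumes "g \<in> Onn" "invertible (blockD g)"
  shows "0 < det g"
proof -
  obtain A B where g: "g = block_matrix A B (blockC g) (blockD g)"
    by (rule block_matrix_exhaust)
  define C D where "C = blockC g" "D = blockD g"
  obtain D' where D': "D ** D' = mat 1" "D' ** D = mat 1"
    using assms(2) unfolding invertible_def C_D_def by blast
  have "block_matrix (mat 1) 0 0 D ** block_matrix (mat 1) 0 0 D' = mat 1"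
    by (simp add: block_matrix_mult D' block_matrix_one)
  then have "det (block_matrix (mat 1) 0 0 D) * det (block_matrix (mat 1) 0 0 D') = 1"
    by (simp only: det_mul[symmetric] det_I)
  then have nz: "det (block_matrix (mat 1) 0 0 D) \<noteq> 0"
    by auto
  have "transpose g ** swap_matrix ** g = swap_matrix"
    using assms(1) by (simp add: Onn_iff)
  then have rel: "transpose D ** A + transpose B ** C = mat 1" "transpose D ** B + transpose B ** D = 0"
    unfolding g[folded C_D_def]
    by (simp_all add: transpose_block_matrix block_matrix_mult block_matrix_eq_iff add.commute)
  \<comment> \<open>The multiplier is chosen so that the upper blocks of the product are the
    left-hand sides of \<open>rel\<close>.\<close>
  have "block_matrix (transpose D) (transpose B) 0 (mat 1) ** g = block_matrix (mat 1) 0 C D"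
    unfolding g[folded C_D_def] by (simp add: block_matrix_mult rel)
  also have "\<dots> = block_matrix (mat 1) 0 0 D ** block_matrix (mat 1) 0 (D' ** C) (mat 1)"
    by (simp add: block_matrix_mult matrix_mul_assoc D')
  also have "block_matrix (transpose D) (transpose B) 0 (mat 1) =
      block_matrix (mat 1) (transpose B) 0 (mat 1) ** block_matrix (transpose D) 0 0 (mat 1)"
    by (simp add: block_matrix_mult)
  finally have eq: "block_matrix (mat 1) (transpose B) 0 (mat 1) ** block_matrix (transpose D) 0 0 (mat 1) ** g
      = block_matrix (mat 1) 0 0 D ** block_matrix (mat 1) 0 (D' ** C) (mat 1)" .
  have "det (block_matrix (mat 1) (transpose B) 0 (mat 1)) * det g
      = det (block_matrix (mat 1) 0 (D' ** C) (mat 1))"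
    using arg_cong[OF eq, of det] nz by (simp add: det_block_diagonal_swap det_mul mult_ac)
  then show ?thesis
    using det_block_unipotent_pos by (metis zero_less_mult_pos)
qed

section \<open>Selecting columns from \<open>C\<close> and \<open>D\<close>\<close>

text \<open>For \<open>x\<close> in the kernel of \<open>transpose (C + D)\<close>, the vectors
  \<open>y = transpose C *v x\<close> and \<open>z = transpose D *v x\<close> are opposite.
  Antisymmetry of \<open>C ** transpose D\<close> makes them orthogonal, so both vanish.\<close>

lemma det_blockC_plus_blockD_nonzero:
  assumes "g \<in> Onn"
  shows "det (blockC g + blockD g) \<noteq> 0"
proof -
  obtain A B where g: "g = block_matrix A B (blockC g) (blockD g)"
    by (rule block_matrix_exhaust)
  define C D where CD: "C = blockC g" "D = blockD g"
  have "g ** swap_matrix ** transpose g = swap_matrix"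
    using assms by (rule Onn_transpose)
  then have rel: "A ** transpose D + B ** transpose C = mat 1" "C ** transpose D + D ** transpose C = 0"
    unfolding g[folded CD]
    by (simp_all add: transpose_block_matrix block_matrix_mult block_matrix_eq_iff add.commute)
  have "x = 0" if "transpose (C + D) *v x = 0" for x
  proof -
    define y z where yz: "y = transpose C *v x" "z = transpose D *v x"
    have "transpose (C + D) = transpose C + transpose D"
      by (simp add: transpose_def vec_eq_iff)
    then have z: "z = - y"
      using that by (simp add: yz matrix_vector_mult_add_rdistrib eq_neg_iff_add_eq_0 add.commute)
    have inner: "x \<bullet> ((M ** N) *v x) = (transpose M *v x) \<bullet> (N *v x)" for M N :: "real^'a^'a"
      by (simp add: dot_lmul_matrix flip: matrix_vector_mul_assoc)
    have "0 = x \<bullet> ((C ** transpose D + D ** transpose C) *v x)"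
      by (simp only: rel matrix_vector_mult_0 inner_zero_right)
    also have "\<dots> = 2 * (y \<bullet> z)"
      by (simp only: matrix_vector_mult_add_rdistrib inner_add_right inner yz inner_commute mult_2)
    finally have "y = 0" "z = 0" using z by auto
    \<comment> \<open>The full rank of \<open>(C D)\<close> enters here: the first relation recovers
      \<open>x\<close> from \<open>y\<close> and \<open>z\<close>.\<close>
    have "x = (A ** transpose D + B ** transpose C) *v x"
      by (simp only: rel matrix_vector_mul_lid)
    also have "\<dots> = A *v z + B *v y"
      by (simp only: matrix_vector_mult_add_rdistrib yz matrix_vector_mul_assoc)
    finally show "x = 0" using \<open>y = 0\<close> \<open>z = 0\<close> by simp
  qed
  then have "invertible (transpose (C + D))"
    by (simp add: invertible_left_inverse matrix_left_invertible_ker)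
  then show ?thesis
    by (simp add: invertible_det_nz CD)
qed

text \<open>Multilinearity: splitting one row that is a sum writes a nonzero determinant as a sum of
  two, at least one of which is nonzero.\<close>

lemma det_row_selection_nonzero:
  fixes a b :: "'n \<Rightarrow> real^'n"
  assumes "det (\<chi> i. a i + b i) \<noteq> 0"
  obtains S where "det (\<chi> i. if i \<in> S then a i else b i) \<noteq> 0"
proof -
  \<comment> \<open>Rows in \<open>T\<close> are already decided according to \<open>S\<close>; the
    others are still sums.\<close>
  let ?M = "\<lambda>T S. \<chi> i. if i \<in> T then (if i \<in> S then a i else b i) else a i + b i"
  have "\<exists>S. det (?M T S) \<noteq> 0" if "finite T" for T
    using that
  proof (induction T)
    case empty
    then show ?case using assms by simp
  next
    case (insert k T)
    then obtain S where S: "det (?M T S) \<noteq> 0" by blast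
    let ?c = "\<lambda>i. ?M T S $ i"
    have "?M T S = (\<chi> i. if i = k then a i + b i else ?c i)"
      using insert.hyps by (auto simp: vec_eq_iff)
    moreover have "(\<chi> i. if i = k then a i else ?c i) = ?M (insert k T) (insert k S)"
      "(\<chi> i. if i = k then b i else ?c i) = ?M (insert k T) (S - {k})"
      by (auto simp: vec_eq_iff)
    ultimately have "det (?M T S) = det (?M (insert k T) (insert k S)) + det (?M (insert k T) (S - {k}))"
      using det_row_add[of k a b ?c] by simp
    with S show ?case by (metis add.right_neutral)
  qed
  from this[of UNIV] show thesis using that by auto
qed

section \<open>Coordinate projections and partial swaps\<close>

definition coord_proj :: "'n set \<Rightarrow> real^'n^'n" where
  "coord_proj S = (\<chi> i j. if i = j \<and> i \<in> S then 1 else 0)"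

lemma matrix_mult_coord_proj_nth: "(M ** coord_proj S) $ i $ j = (if j \<in> S then M $ i $ j else 0)"
proof -
  have "(M ** coord_proj S) $ i $ j = (\<Sum>k\<in>UNIV. if k = j then (if j \<in> S then M $ i $ j else 0) else 0)"
    unfolding matrix_matrix_mult_def coord_proj_def vec_lambda_beta by (rule sum.cong) auto
  then show ?thesis by simp
qed

lemma coord_proj_mult: "coord_proj S ** coord_proj T = coord_proj (S \<inter> T)"
  by (simp add: vec_eq_iff matrix_mult_coord_proj_nth) (auto simp: coord_proj_def)

lemma coord_proj_Un: "S \<inter> T = {} \<Longrightarrow> coord_proj S + coord_proj T = coord_proj (S \<union> T)"
  by (auto simp: coord_proj_def vec_eq_iff)

lemma coord_proj_UNIV: "coord_proj UNIV = mat 1"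
  by (simp add: coord_proj_def mat_def)

lemma coord_proj_empty: "coord_proj {} = 0"
  by (simp add: coord_proj_def vec_eq_iff)

lemma transpose_coord_proj: "transpose (coord_proj S) = coord_proj S"
  by (auto simp: coord_proj_def transpose_def vec_eq_iff)

text \<open>Exchanges \<open>a^i\<close> and \<open>b_i\<close> for \<open>i \<in> S\<close>;
  multiplying by it on the right trades the corresponding columns of \<open>C\<close> and
  \<open>D\<close>.\<close>

definition partial_swap :: "'n::finite set \<Rightarrow> real^('n + 'n)^('n + 'n)" where
  "partial_swap S = block_matrix (coord_proj (- S)) (coord_proj S) (coord_proj S) (coord_proj (- S))"

lemma partial_swap_Onn: "partial_swap S \<in> Onn"
  unfolding Onn_iff partial_swap_def
  by (simp add: transpose_block_matrix block_matrix_mult transpose_coord_proj coord_proj_mult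
      coord_proj_Un coord_proj_UNIV coord_proj_empty Un_commute[of S])

text \<open>Swapping one pair permutes the rows of the identity by a transposition; a general
  partial swap is a product of such swaps.\<close>

lemma det_partial_swap: "det (partial_swap S) = (- 1) ^ card S"
proof -
  have single: "det (partial_swap {k}) = - 1" for k :: 'a
  proof -
    let ?p = "Transposition.transpose (Inl k) (Inr k) :: 'a + 'a \<Rightarrow> 'a + 'a"
    have "partial_swap {k} = (\<chi> i. (mat 1 :: real^('a + 'a)^('a + 'a)) $ ?p i)"
      by (rule sum_type_matrix_eqI)
        (auto simp: partial_swap_def coord_proj_def mat_def Transposition.transpose_def)
    then show ?thesis
      by (simp add: det_permute_rows permutes_swap_id sign_swap_id)
  qed
  have "finite S" by simp
  then show ?thesis
  proof (induction S)
    case empty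
    show ?case
      by (simp add: partial_swap_def coord_proj_empty coord_proj_UNIV block_matrix_one)
  next
    case (insert k S)
    have "partial_swap S ** partial_swap {k} = partial_swap (insert k S)"
      using insert.hyps unfolding partial_swap_def block_matrix_mult coord_proj_mult block_matrix_eq_iff
      by (auto simp: coord_proj_def vec_eq_iff)
    then show ?case
      using insert by (metis card_insert_disjoint det_mul mult.commute power_Suc single)
  qed
qed

text \<open>The selected matrix is the lower right block of \<open>g ** partial_swap S\<close>, so
  this element of \<open>Onn\<close> has positive determinant; but its determinant is
  \<open>det g * (- 1) ^ card S\<close>.\<close>

lemma even_card_if_partial_swap_blockD_invertible:
  assumes "g \<in> Onn" "0 < det g" "det (blockC g ** coord_proj S + blockD g ** coord_proj (- S)) \<noteq> 0"
  shows "even (card S)"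
proof -
  obtain A B where g: "g = block_matrix A B (blockC g) (blockD g)"
    by (rule block_matrix_exhaust)
  have "blockD (g ** partial_swap S) = blockC g ** coord_proj S + blockD g ** coord_proj (- S)"
    by (subst g) (simp add: partial_swap_def block_matrix_mult)
  then have "0 < det (g ** partial_swap S)"
    using assms by (intro det_pos_if_blockD_invertible Onn_mult partial_swap_Onn)
      (auto simp: invertible_det_nz)
  then show ?thesis
    using assms(2) by (auto simp: det_mul det_partial_swap zero_less_mult_iff zero_less_power_eq)
qed

section \<open>An antisymmetric point in the domain of each \<open>g\<close>\<close>

lemma transpose_add: "transpose (M + N) = transpose M + transpose N"
  by (simp add: transpose_def vec_eq_iff)

lemma matrix_add_rdistrib: "(M + N) ** K = M ** K + N ** K"
  by (simp add: matrix_matrix_mult_def vec_eq_iff distrib_right sum.distrib)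

lemma matrix_mult_minus:
  fixes M :: "real^'n^'m" and N :: "real^'k^'n"
  shows "(- M) ** N = - (M ** N)" "M ** (- N) = - (M ** N)"
  by (simp_all add: matrix_matrix_mult_def vec_eq_iff sum_negf)

text \<open>The determinant is a polynomial in \<open>t\<close>, and one nonzero value rules out the
  zero polynomial.\<close>

lemma det_pencil_finite_zeros:
  fixes M N :: "real^'n^'n"
  assumes "det (M + t *\<^sub>R N) \<noteq> 0"
  shows "finite {t. det (M + t *\<^sub>R N) = 0}"
proof -
  have "real_polynomial_function (\<lambda>t. M $ i $ j + t * N $ i $ j)" for i j
    by (intro real_polynomial_function.intros) (auto intro: bounded_linear_ident)
  then have "real_polynomial_function (\<lambda>t. det (M + t *\<^sub>R N))"
    unfolding det_def
    by (intro real_polynomial_function_sum real_polynomial_function.intros(2,4) real_polynomial_function_prod)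
      (auto simp: finite_permutations)
  then obtain c n where p: "(\<lambda>t. det (M + t *\<^sub>R N)) = (\<lambda>t. \<Sum>i\<le>n. c i * t ^ i)"
    unfolding real_polynomial_function_iff_sum by blast
  then have "(\<Sum>i\<le>n. c i * t ^ i) \<noteq> 0"
    using assms fun_cong[OF p, of t] by simp
  then have "\<exists>i\<le>n. c i \<noteq> 0"
    by (auto intro: ccontr)
  then show ?thesis
    unfolding fun_cong[OF p] by (simp only: polyfun_finite_roots)
qed

text \<open>Pair up the elements of \<open>S\<close> and put a rotation by a right angle on each
  pair. The last two identities say that \<open>J\<close> lives on the coordinates in
  \<open>S\<close>.\<close>

lemma symplectic_matrix_on_even_set:
  fixes S :: "'n::finite set"
  assumes "even (card S)"
  obtains J :: "real^'n^'n" where "transpose J = - J" "J ** J = - coord_proj S"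
    "J ** coord_proj S = J" "coord_proj S ** J = J"
proof -
  let ?P = "\<lambda>S J :: real^'n^'n. transpose J = - J \<and> J ** J = - coord_proj S \<and>
    J ** coord_proj S = J \<and> coord_proj S ** J = J"
  have "\<exists>J. ?P S J" if "card S = 2 * m" for m
    using that
  proof (induction m arbitrary: S)
    case 0
    then have "S = {}" by simp
    then show ?case
      by (intro exI[of _ 0]) (simp add: coord_proj_empty)
  next
    case (Suc m)
    then have "card S = Suc (Suc (2 * m))" by simp
    then obtain a b T where S: "S = insert a (insert b T)" "a \<noteq> b" "a \<notin> T" "b \<notin> T" "card T = 2 * m"
      by (auto simp: card_Suc_eq)
    obtain J where J: "?P T J" using Suc.IH[OF S(5)] by blast
    \<comment> \<open>The rotation block for the new pair \<open>a\<close>,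
      \<open>b\<close>.\<close>
    define E :: "real^'n^'n" where
      "E = (\<chi> i j. if i = a \<and> j = b then 1 else if i = b \<and> j = a then - 1 else 0)"
    have tE: "transpose E = - E"
      using S(2) by (auto simp: E_def transpose_def vec_eq_iff)
    have E1: "E ** coord_proj {a, b} = E"
      by (auto simp: vec_eq_iff matrix_mult_coord_proj_nth) (auto simp: E_def)
    have E2: "coord_proj {a, b} ** E = E"
      using arg_cong[OF E1, of transpose] by (simp add: matrix_transpose_mul transpose_coord_proj tE matrix_mult_minus)
    have EE: "E ** E = - coord_proj {a, b}"
    proof -
      have "(E ** E) $ i $ j = - coord_proj {a, b} $ i $ j" for i j
      proof -
        consider "i = a" | "i = b" | "i \<noteq> a" "i \<noteq> b" by blast
        then show ?thesis
        proof cases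
          case 1
          have "E $ a $ k = (if k = b then 1 else 0)" for k
            using S(2) by (simp add: E_def)
          then have "(E ** E) $ a $ j = E $ b $ j"
            by (simp add: matrix_matrix_mult_def if_distrib[of "\<lambda>x. x * _"] cong: if_cong)
          then show ?thesis using 1 S(2) by (simp add: E_def coord_proj_def)
        next
          case 2
          have "E $ b $ k = (if k = a then - 1 else 0)" for k
            using S(2) by (simp add: E_def)
          then have "(E ** E) $ b $ j = - E $ a $ j"
            by (simp add: matrix_matrix_mult_def if_distrib[of "\<lambda>x. x * _"] cong: if_cong)
          then show ?thesis using 2 S(2) by (simp add: E_def coord_proj_def)
        next
          case 3
          then have "E $ i $ k = 0" for k
            by (simp add: E_def)
          then show ?thesis using 3 by (simp add: matrix_matrix_mult_def coord_proj_def)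
        qed
      qed
      then show ?thesis by (simp add: vec_eq_iff)
    qed
    have disj: "T \<inter> {a, b} = {}" "{a, b} \<inter> T = {}" using S by auto
    \<comment> \<open>Matrices with disjoint supports multiply to zero, which removes the cross
      terms in the products with \<open>J + E\<close>.\<close>
    have zero: "(M ** coord_proj A) ** (coord_proj B ** N) = 0" if "A \<inter> B = {}" for A B and M N :: "real^'n^'n"
    proof -
      have "(M ** coord_proj A) ** (coord_proj B ** N) = M ** (coord_proj A ** coord_proj B) ** N"
        by (simp only: matrix_mul_assoc)
      then show ?thesis
        by (simp add: coord_proj_mult that coord_proj_empty)
    qed
    have JE: "J ** E = 0" "E ** J = 0" "J ** coord_proj {a, b} = 0" "coord_proj {a, b} ** J = 0"
      "E ** coord_proj T = 0" "coord_proj T ** E = 0"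
      using zero[OF disj(1), of J E] zero[OF disj(2), of E J] zero[OF disj(1), of J "mat 1"]
        zero[OF disj(2), of "mat 1" J] zero[OF disj(2), of E "mat 1"] zero[OF disj(1), of "mat 1" E]
      by (simp_all only: J E1 E2 matrix_mul_lid matrix_mul_rid)
    have PS: "coord_proj S = coord_proj T + coord_proj {a, b}"
      using disj S(1) by (simp add: coord_proj_Un)
    have "?P S (J + E)"
    proof (intro conjI)
      show "transpose (J + E) = - (J + E)"
        using J tE by (simp add: transpose_add)
    qed (use J in \<open>simp_all add: PS matrix_add_ldistrib matrix_add_rdistrib JE EE E1 E2\<close>)
    then show ?case by blast
  qed
  from this[of "card S div 2"] assms that show thesis by auto
qed

text \<open>Take \<open>J / s\<close> as the point. Multiplying \<open>C ** (J / s) + D\<close> by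
  \<open>Q + s P\<close> gives the pencil \<open>M + s (D ** P)\<close>, which is invertible at
  \<open>s = 0\<close> and hence for all but finitely many \<open>s\<close>.\<close>

lemma exists_antisym_det_nonzero_of_column_selection:
  fixes C D :: "real^'n^'n"
  assumes "even (card S)" and det: "det (C ** coord_proj S + D ** coord_proj (- S)) \<noteq> 0"
  shows "\<exists>\<theta>\<in>antisym_matrices. det (C ** \<theta> + D) \<noteq> 0"
proof -
  obtain J :: "real^'n^'n" where J: "transpose J = - J" "J ** J = - coord_proj S"
      "J ** coord_proj S = J" "coord_proj S ** J = J"
    using assms(1) by (rule symplectic_matrix_on_even_set)
  define P Q :: "real^'n^'n" where PQ: "P = coord_proj S" "Q = coord_proj (- S)"
  have PQ0: "P ** Q = 0" "Q ** P = 0" and QQ: "Q ** Q = Q" and PaQ: "P + Q = mat 1"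
    by (simp_all add: PQ coord_proj_mult coord_proj_Un coord_proj_empty coord_proj_UNIV)
  have JQ: "J ** Q = 0" "Q ** J = 0"
  proof -
    have "J ** Q = J ** (P ** Q)" "Q ** J = (Q ** P) ** J"
      using J(3,4)[folded PQ(1)] by (simp_all only: matrix_mul_assoc) (simp only: flip: matrix_mul_assoc)
    then show "J ** Q = 0" "Q ** J = 0" by (simp_all add: PQ0)
  qed
  define M where "M = C ** J + D ** Q"
  have fac: "(C ** P + D ** Q) ** (J + Q) = M"
    using J(4)[folded PQ(1)]
    by (simp add: M_def matrix_add_ldistrib matrix_add_rdistrib PQ0 QQ JQ flip: matrix_mul_assoc)
  \<comment> \<open>On the coordinates in \<open>S\<close> the inverse of \<open>J\<close> is
    \<open>- J\<close>, and on the others \<open>Q\<close> is the identity.\<close>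
  have "(J + Q) ** (Q - J) = mat 1"
    using PaQ J(2)[folded PQ(1)] add.commute[of Q P]
    by (simp add: diff_conv_add_uminus matrix_add_ldistrib matrix_add_rdistrib QQ JQ matrix_mult_minus del: add_uminus_conv_diff)
  then have "det (J + Q) \<noteq> 0"
    using invertible_det_nz invertible_right_inverse by blast
  then have "det M \<noteq> 0"
    using det unfolding fac[symmetric] det_mul PQ by simp
  then have "finite {s. det (M + s *\<^sub>R (D ** P)) = 0}"
    by (intro det_pencil_finite_zeros[of _ 0]) simp
  \<comment> \<open>Zero is excluded as well, since the chosen \<open>s\<close> becomes a
    denominator.\<close>
  then have "finite (insert 0 {s. det (M + s *\<^sub>R (D ** P)) = 0})"
    by simp
  then obtain s where s: "s \<noteq> 0" "det (M + s *\<^sub>R (D ** P)) \<noteq> 0"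
    using ex_new_if_finite[OF infinite_UNIV_char_0] by blast
  have "(C ** ((1/s) *\<^sub>R J) + D) ** (Q + s *\<^sub>R P) = M + s *\<^sub>R (D ** P)"
    using J(3)[folded PQ(1)] s(1)
    by (simp add: M_def matrix_add_ldistrib matrix_add_rdistrib scalar_matrix_assoc[symmetric]
        matrix_scalar_ac JQ scaleR_add_right flip: matrix_mul_assoc)
  then have "det (C ** ((1/s) *\<^sub>R J) + D) \<noteq> 0"
    using s(2) by (metis det_mul mult_zero_left)
  moreover have "(1/s) *\<^sub>R J \<in> antisym_matrices"
    using J(1) by (simp add: antisym_matrices_def transpose_scalar)
  ultimately show ?thesis by blast
qed

lemma exists_antisym_action_defined:
  assumes "g \<in> Onn" "0 < det g"
  shows "\<exists>\<theta>\<in>antisym_matrices. action_defined g \<theta>"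
proof -
  let ?C = "blockC g" and ?D = "blockD g"
  \<comment> \<open>Row selection is applied to the transposed matrices, because here columns are to
    be selected.\<close>
  have "det (\<chi> i. column i ?C + column i ?D) \<noteq> 0"
  proof -
    have "(\<chi> i. column i ?C + column i ?D) = transpose (?C + ?D)"
      by (simp add: vec_eq_iff column_def transpose_def)
    then show ?thesis using det_blockC_plus_blockD_nonzero[OF assms(1)] by simp
  qed
  then obtain S where S: "det (\<chi> i. if i \<in> S then column i ?C else column i ?D) \<noteq> 0"
    by (rule det_row_selection_nonzero)
  have "(\<chi> i. if i \<in> S then column i ?C else column i ?D)
      = transpose (?C ** coord_proj S + ?D ** coord_proj (- S))"
    by (simp add: vec_eq_iff column_def transpose_def matrix_mult_coord_proj_nth)
  then have det: "det (?C ** coord_proj S + ?D ** coord_proj (- S)) \<noteq> 0"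
    using S by simp
  then show ?thesis
    using exists_antisym_det_nonzero_of_column_selection
      even_card_if_partial_swap_blockD_invertible[OF assms det]
    by (simp add: action_defined_def invertible_det_nz)
qed

section \<open>Countability, density and the Baire argument\<close>

lemma countable_SOnnZ: "countable (SOnnZ :: (real^('n::finite + 'n)^('n + 'n)) set)"
proof -
  have "SOnnZ \<subseteq> range (\<lambda>M :: int^('n + 'n)^('n + 'n). \<chi> i j. real_of_int (M $ i $ j))"
  proof
    fix g :: "real^('n + 'n)^('n + 'n)" assume "g \<in> SOnnZ"
    then have "g = (\<chi> i j. real_of_int ((\<chi> i j. \<lfloor>g $ i $ j\<rfloor>) $ i $ j))"
      by (simp add: SOnnZ_def vec_eq_iff)
    then show "g \<in> range (\<lambda>M :: int^('n + 'n)^('n + 'n). \<chi> i j. real_of_int (M $ i $ j))"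
      by blast
  qed
  then show ?thesis
    by (rule countable_subset) simp
qed

lemma subspace_antisym_matrices: "subspace antisym_matrices"
  by (simp add: subspace_def antisym_matrices_def transpose_add transpose_scalar)

text \<open>Join \<open>\<theta>\<close> to \<open>\<theta>1\<close> by a line. The determinant
  along it is a polynomial in \<open>t\<close>, nonzero at \<open>t = 1\<close>, so points of the
  line with nonzero determinant accumulate at \<open>\<theta>\<close>.\<close>

lemma dense_det_nonzero:
  fixes C D :: "real^'n^'n"
  assumes V: "subspace V" and \<theta>1: "\<theta>1 \<in> V" "det (C ** \<theta>1 + D) \<noteq> 0"
  shows "V \<subseteq> closure {\<theta> \<in> V. det (C ** \<theta> + D) \<noteq> 0}"
proof
  fix \<theta> assume "\<theta> \<in> V"
  define l where "l t = \<theta> + t *\<^sub>R (\<theta>1 - \<theta>)" for t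
  define Z where "Z = {t. det (C ** l t + D) = 0}"
  have eq: "C ** l t + D = (C ** \<theta> + D) + t *\<^sub>R (C ** (\<theta>1 - \<theta>))" for t
    by (simp add: l_def matrix_add_ldistrib matrix_scalar_ac scalar_matrix_assoc[symmetric])
  have "det ((C ** \<theta> + D) + 1 *\<^sub>R (C ** (\<theta>1 - \<theta>))) \<noteq> 0"
    using \<theta>1(2) unfolding eq[symmetric] by (simp add: l_def)
  from det_pencil_finite_zeros[OF this] have "finite Z"
    unfolding Z_def eq .
  then have "0 \<in> closure (- Z)"
    by (simp add: closure_complement empty_interior_finite)
  moreover have "continuous_on (closure (- Z)) l"
    unfolding l_def by (intro continuous_intros)
  ultimately have "l 0 \<in> closure (l ` (- Z))"
    using image_closure_subset[OF _ closed_closure closure_subset] by blast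
  then have "\<theta> \<in> closure (l ` (- Z))"
    by (simp add: l_def)
  moreover have "l ` (- Z) \<subseteq> {\<theta> \<in> V. det (C ** \<theta> + D) \<noteq> 0}"
    using V \<theta>1 \<open>\<theta> \<in> V\<close> by (auto simp: Z_def l_def subspace_add subspace_diff subspace_scale)
  ultimately show "\<theta> \<in> closure {\<theta> \<in> V. det (C ** \<theta> + D) \<noteq> 0}"
    using subsetD[OF closure_mono] by blast
qed

lemma open_det_nonzero:
  fixes C D :: "real^'n^'n"
  shows "open {\<theta>. det (C ** \<theta> + D) \<noteq> 0}"
proof -
  have "continuous_on UNIV (\<lambda>\<theta>. det (C ** \<theta> + D))"
    unfolding det_def matrix_matrix_mult_def vec_lambda_beta plus_vec_def
    by (intro continuous_intros)
  then show ?thesis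
    by (intro open_Collect_neq) auto
qed

theorem mainTheorem2:
  shows "top_of_set antisym_matrices closure_of antisym_matrices0
           = (antisym_matrices :: (real^'n^'n) set)
       \<and> second_category_in (top_of_set antisym_matrices)
           (antisym_matrices0 :: (real^'n^'n) set)"
proof -
  let ?V = "antisym_matrices :: (real^'n^'n) set" and ?X = "top_of_set (antisym_matrices :: (real^'n^'n) set)"
  let ?U = "\<lambda>g. {\<theta> \<in> ?V. action_defined g \<theta>}"
  \<comment> \<open>With \<open>?V\<close> as a member, the intersection lies in \<open>?V\<close>
    without recourse to an element of \<open>SOnnZ\<close>.\<close>
  define \<G> where "\<G> = insert ?V (?U ` SOnnZ)"
  have closed: "closed ?V"
    by (rule closed_subspace[OF subspace_antisym_matrices])
  have cG: "countable \<G>"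
    by (simp add: \<G>_def countable_SOnnZ)
  have G: "openin ?X T \<and> ?V \<subseteq> closure T" if TG: "T \<in> \<G>" for T
  proof -
    consider "T = ?V" | g where "g \<in> SOnnZ" "T = ?U g"
      using TG unfolding \<G>_def by blast
    then show ?thesis
    proof cases
      case 1
      then show ?thesis by (simp add: closure_subset)
    next
      case 2
      then have g: "g \<in> Onn" "0 < det g" by (auto simp: SOnnZ_def)
      have T: "T = {\<theta> \<in> ?V. det (blockC g ** \<theta> + blockD g) \<noteq> 0}"
        by (simp add: 2 action_defined_def invertible_det_nz)
      obtain \<theta>1 where "\<theta>1 \<in> ?V" "det (blockC g ** \<theta>1 + blockD g) \<noteq> 0"
        using exists_antisym_action_defined[OF g] by (auto simp: action_defined_def invertible_det_nz)
      then have "?V \<subseteq> closure T"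
        unfolding T by (intro dense_det_nonzero subspace_antisym_matrices)
      moreover have "openin ?X (?V \<inter> {\<theta>. det (blockC g ** \<theta> + blockD g) \<noteq> 0})"
        by (intro openin_open_Int open_det_nonzero)
      ultimately show ?thesis by (simp add: T Int_def)
    qed
  qed
  have V0: "\<Inter>\<G> = antisym_matrices0"
    by (auto simp: \<G>_def antisym_matrices0_def)
  have sub: "antisym_matrices0 \<subseteq> ?V"
    by (auto simp: antisym_matrices0_def)
  have "?V \<subseteq> closure antisym_matrices0"
    using Baire[OF closed cG G] by (simp only: V0)
  then have dense: "?X closure_of antisym_matrices0 = ?V"
    using sub by (simp add: closure_of_subtopology Int_absorb1 Int_absorb2)
  have "\<not> first_category_in ?X antisym_matrices0"
  proof
    assume "first_category_in ?X antisym_matrices0"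
    then obtain \<N> where \<N>: "countable \<N>" "\<And>N. N \<in> \<N> \<Longrightarrow> nowhere_dense_in ?X N"
        "antisym_matrices0 = \<Union>\<N>"
      unfolding first_category_in_def by blast
    \<comment> \<open>If nowhere dense sets covered \<open>antisym_matrices0\<close>, the
      complements of their closures could join \<open>\<G>\<close> as further dense open sets. The
      enlarged family then has empty intersection, against Baire.\<close>
    define \<H> where "\<H> = \<G> \<union> (\<lambda>N. ?V - ?X closure_of N) ` \<N>"
    have "countable \<H>" using cG \<N>(1) by (simp add: \<H>_def)
    moreover have "openin ?X T \<and> ?V \<subseteq> closure T" if TH: "T \<in> \<H>" for T
    proof (cases "T \<in> \<G>")
      case False
      then obtain N where N: "N \<in> \<N>" and T: "T = ?V - ?X closure_of N"
        using TH by (auto simp: \<H>_def)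
      \<comment> \<open>The closure of a complement is the complement of the interior, here empty as
        \<open>N\<close> is nowhere dense.\<close>
      have "?X closure_of (topspace ?X - ?X closure_of N) = topspace ?X"
        using \<N>(2)[OF N] unfolding closure_of_complement nowhere_dense_in_def by simp
      then have "?V \<inter> closure (?V \<inter> T) = ?V"
        by (simp add: T closure_of_subtopology)
      then have "?V \<subseteq> closure T"
        using closure_mono[of "?V \<inter> T" T] by blast
      moreover have "openin ?X (topspace ?X - ?X closure_of N)"
        by (intro openin_diff openin_topspace closedin_closure_of)
      then have "openin ?X T"
        by (simp add: T)
      ultimately show ?thesis by blast
    qed (use G in blast)
    ultimately have "?V \<subseteq> closure (\<Inter>\<H>)"
      by (rule Baire[OF closed])
    moreover have "\<Inter>\<H> = {}"
    proof -
      have "\<Inter>\<H> \<subseteq> antisym_matrices0"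
        unfolding V0[symmetric] \<H>_def by blast
      moreover have "N \<subseteq> ?X closure_of N" if "N \<in> \<N>" for N
        using \<N>(2)[OF that] by (simp add: nowhere_dense_in_def closure_of_subset)
      then have "\<Inter>\<H> \<inter> \<Union>\<N> = {}"
        unfolding \<H>_def by blast
      ultimately show ?thesis using \<N>(3) by blast
    qed
    ultimately show False
      \<comment> \<open>The zero matrix lies in \<open>?V\<close> but not in the closure of the
        empty set.\<close>
      using subspace_0[OF subspace_antisym_matrices] by auto
  qed
  then show ?thesis
    using dense sub by (simp add: second_category_in_def)
qed

end
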